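(* The properties $(UW_{\Pi})$ and $(Z_{\Pi_a})$ are independent, i.e. neither implies the other: there exist an infinite-dimensional complex Banach space $X$ and an operator $T\in L(X)$ that satisfies $(UW_{\Pi})$ but not $(Z_{\Pi_a})$, and there exist an infinite-dimensional complex Banach space $Y$ and an operator $S\in L(Y)$ that satisfies $(Z_{\Pi_a})$ but not $(UW_{\Pi})$.
   Context: $L(X)$ is the algebra of bounded linear operators on $X$. For $T\in L(X)$, $\alpha(T)=\dim \mathcal{N}(T)$ (kernel) and $\beta(T)=\operatorname{codim}\mathcal{R}(T)$ (range); the index is $\alpha(T)-\beta(T)$. The ascent is $p(T)=\inf\{n\in\mathbb{N}:\mathcal{N}(T^n)=\mathcal{N}(T^{n+1})\}$ and the descent is $q(T)=\inf\{n\in\mathbb{N}:\mathcal{R}(T^n)=\mathcal{R}(T^{n+1})\}$ ($n\ge 0$, $\inf\emptyset=\infty$). $\sigma(T)$ is the spectrum and $\sigma_a(T)$ the approximate point spectrum. $T$ is upper semi-Fredholm if $\mathcal{R}(T)$ is closed and $\alpha(T)<\infty$. Weyl spectrum: $\sigma_w(T)$ is the set of $\lambda\in\mathbb{C}$ such that $T-\lambda I$ is not Fredholm of index $0$. Upper semi-Weyl spectrum: $\sigma_{uw}(T)$ is the set of $\lambda$ such that $T-\lambda I$ is not an upper semi-Fredholm operator of index $\le 0$. Put $\Delta(T)=\sigma(T)\setminus\sigma_w(T)$ and $\Delta_a(T)=\sigma_a(T)\setminus\sigma_{uw}(T)$. $\Pi(T)$ is the set of poles of $T$: those $\lambda\in\sigma(T)$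 with $p(T-\lambda I)<\infty$ and $q(T-\lambda I)<\infty$. $\Pi_a(T)$ is the set of left poles of $T$: those $\lambda\in\sigma_a(T)$ such that $p:=p(T-\lambda I)<\infty$ and $\mathcal{R}((T-\lambda I)^{p+1})$ is closed. $T$ satisfies property $(UW_{\Pi})$ if $\Delta_a(T)=\Pi(T)$; $T$ satisfies property $(Z_{\Pi_a})$ if $\Delta(T)=\Pi_a(T)$. *)

theory Defs
  imports "HOL-Analysis.Analysis" "HOL-Library.Function_Algebras"
begin

text \<open>
  A complex normed space is a linear subspace \<open>X\<close> of some ambient complex vector space,
  with a norm that is only constrained on \<open>X\<close>.  Carriers are sets rather than types,
  so that one can quantify over spaces inside a formula.
\<close>

locale complex_normed_space = vector_space scale
  for scale :: "complex \<Rightarrow> 'a::ab_group_add \<Rightarrow> 'a" +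
  fixes X :: "'a set" and nrm :: "'a \<Rightarrow> real"
  assumes subspace_X: "subspace X"
    and nrm_nonneg: "x \<in> X \<Longrightarrow> 0 \<le> nrm x"
    and nrm_eq_0_iff: "x \<in> X \<Longrightarrow> nrm x = 0 \<longleftrightarrow> x = 0"
    and nrm_triangle: "x \<in> X \<Longrightarrow> y \<in> X \<Longrightarrow> nrm (x + y) \<le> nrm x + nrm y"
    and nrm_scale: "x \<in> X \<Longrightarrow> nrm (scale c x) = cmod c * nrm x"
begin

text \<open>
  The locale \<open>Metric_space\<close> demands nonnegativity and symmetry also off the carrier,
  where \<open>nrm\<close> is unconstrained; hence the default value 0 there.
\<close>

definition mdist :: "'a \<Rightarrow> 'a \<Rightarrow> real" where
  "mdist x y = (if x \<in> X \<and> y \<in> X then nrm (x - y) else 0)"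

sublocale Metric_space X mdist
proof
  fix x y z
  show "0 \<le> mdist x y"
    by (simp add: mdist_def nrm_nonneg subspace_diff[OF subspace_X])
  have "nrm (x - y) = nrm (y - x)" if "x \<in> X" "y \<in> X"
    using nrm_scale[of "y - x" "-1"] that by (simp add: subspace_diff[OF subspace_X])
  then show "mdist x y = mdist y x"
    by (simp add: mdist_def)
  show "mdist x y = 0 \<longleftrightarrow> x = y" if "x \<in> X" "y \<in> X"
    using that by (simp add: mdist_def nrm_eq_0_iff subspace_diff[OF subspace_X])
  show "mdist x z \<le> mdist x y + mdist y z" if "x \<in> X" "y \<in> X" "z \<in> X"
    using nrm_triangle[of "x - y" "y - z"] that
    by (simp add: mdist_def subspace_diff[OF subspace_X])
qed

text \<open>
  The library's \<open>dim\<close> is 0 for infinite-dimensional spaces, so dimensions are taken in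
  \<^typ>\<open>enat\<close>.  The codimension of \<open>W\<close> in \<open>X\<close>, i.e. the dimension of \<open>X/W\<close>, is the
  dimension of an algebraic complement of \<open>W\<close>; complements always exist and all of them
  have the same dimension, so the infimum merely selects this common value.
\<close>

definition edim :: "'a set \<Rightarrow> enat" where
  "edim S = (if \<exists>B. finite B \<and> S \<subseteq> span B then enat (dim S) else \<infinity>)"

definition codim :: "'a set \<Rightarrow> enat" where
  "codim W = Inf {edim U |U. subspace U \<and> U \<inter> W = {0} \<and> {u + w |u w. u \<in> U \<and> w \<in> W} = X}"

definition infinite_dimensional :: bool where
  "infinite_dimensional \<longleftrightarrow> edim X = \<infinity>"

text \<open>
  An element of \<open>L(X)\<close> is represented by any function on the ambient type that restricts
  to it; the values outside \<open>X\<close> are irrelevant for all notions below.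
\<close>

definition bounded_operator :: "('a \<Rightarrow> 'a) \<Rightarrow> bool" where
  "bounded_operator T \<longleftrightarrow>
     (\<forall>x\<in>X. T x \<in> X) \<and>
     (\<forall>x\<in>X. \<forall>y\<in>X. T (x + y) = T x + T y) \<and>
     (\<forall>c. \<forall>x\<in>X. T (scale c x) = scale c (T x)) \<and>
     (\<exists>K. \<forall>x\<in>X. nrm (T x) \<le> K * nrm x)"

definition shifted :: "('a \<Rightarrow> 'a) \<Rightarrow> complex \<Rightarrow> 'a \<Rightarrow> 'a" where
  "shifted T l = (\<lambda>x. T x - scale l x)"

definition null_space :: "('a \<Rightarrow> 'a) \<Rightarrow> 'a set" where
  "null_space T = {x \<in> X. T x = 0}"

definition range_space :: "('a \<Rightarrow> 'a) \<Rightarrow> 'a set" where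
  "range_space T = T ` X"

definition nullity :: "('a \<Rightarrow> 'a) \<Rightarrow> enat" where
  "nullity T = edim (null_space T)"

definition deficiency :: "('a \<Rightarrow> 'a) \<Rightarrow> enat" where
  "deficiency T = codim (range_space T)"

text \<open>
  Only meaningful if nullity or deficiency is finite; an upper semi-Fredholm operator
  of infinite deficiency has index \<open>-\<infinity>\<close>.
\<close>

definition index :: "('a \<Rightarrow> 'a) \<Rightarrow> ereal" where
  "index T = ereal_of_enat (nullity T) - ereal_of_enat (deficiency T)"

definition ascent :: "('a \<Rightarrow> 'a) \<Rightarrow> enat" where
  "ascent T = Inf {enat n |n. null_space (T ^^ n) = null_space (T ^^ (n + 1))}"

definition descent :: "('a \<Rightarrow> 'a) \<Rightarrow> enat" where
  "descent T = Inf {enat n |n. range_space (T ^^ n) = range_space (T ^^ (n + 1))}"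

definition upper_semi_Fredholm :: "('a \<Rightarrow> 'a) \<Rightarrow> bool" where
  "upper_semi_Fredholm T \<longleftrightarrow> closedin mtopology (range_space T) \<and> nullity T < \<infinity>"

definition Fredholm :: "('a \<Rightarrow> 'a) \<Rightarrow> bool" where
  "Fredholm T \<longleftrightarrow> upper_semi_Fredholm T \<and> deficiency T < \<infinity>"

definition invertible_operator :: "('a \<Rightarrow> 'a) \<Rightarrow> bool" where
  "invertible_operator T \<longleftrightarrow>
     (\<exists>S. bounded_operator S \<and> (\<forall>x\<in>X. S (T x) = x) \<and> (\<forall>x\<in>X. T (S x) = x))"

definition spectrum :: "('a \<Rightarrow> 'a) \<Rightarrow> complex set" where
  "spectrum T = {l. \<not> invertible_operator (shifted T l)}"

definition approximate_point_spectrum :: "('a \<Rightarrow> 'a) \<Rightarrow> complex set" where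
  "approximate_point_spectrum T =
     {l. \<exists>x :: nat \<Rightarrow> 'a. (\<forall>n. x n \<in> X \<and> nrm (x n) = 1) \<and>
           (\<lambda>n. nrm (shifted T l (x n))) \<longlonglongrightarrow> 0}"

definition Weyl_spectrum :: "('a \<Rightarrow> 'a) \<Rightarrow> complex set" where
  "Weyl_spectrum T = {l. \<not> (Fredholm (shifted T l) \<and> index (shifted T l) = 0)}"

definition upper_semi_Weyl_spectrum :: "('a \<Rightarrow> 'a) \<Rightarrow> complex set" where
  "upper_semi_Weyl_spectrum T =
     {l. \<not> (upper_semi_Fredholm (shifted T l) \<and> index (shifted T l) \<le> 0)}"

definition Delta :: "('a \<Rightarrow> 'a) \<Rightarrow> complex set" where
  "Delta T = spectrum T - Weyl_spectrum T"

definition Delta_a :: "('a \<Rightarrow> 'a) \<Rightarrow> complex set" where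
  "Delta_a T = approximate_point_spectrum T - upper_semi_Weyl_spectrum T"

definition poles :: "('a \<Rightarrow> 'a) \<Rightarrow> complex set" where
  "poles T = {l \<in> spectrum T. ascent (shifted T l) < \<infinity> \<and> descent (shifted T l) < \<infinity>}"

definition left_poles :: "('a \<Rightarrow> 'a) \<Rightarrow> complex set" where
  "left_poles T =
     {l \<in> approximate_point_spectrum T.
        \<exists>p. ascent (shifted T l) = enat p \<and>
            closedin mtopology (range_space (shifted T l ^^ (p + 1)))}"

definition property_UW_Pi :: "('a \<Rightarrow> 'a) \<Rightarrow> bool" where
  "property_UW_Pi T \<longleftrightarrow> Delta_a T = poles T"

definition property_Z_Pi_a :: "('a \<Rightarrow> 'a) \<Rightarrow> bool" where
  "property_Z_Pi_a T \<longleftrightarrow> Delta T = left_poles T"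

end

locale complex_banach_space = complex_normed_space +
  assumes complete: mcomplete

text \<open>
  The space of all complex sequences with pointwise operations has Hamel dimension
  continuum.  Hence every complex Banach space of at most that dimension, in particular
  every separable one, is up to isometric isomorphism carried by a subspace of it.
\<close>

definition seq_scale :: "complex \<Rightarrow> (nat \<Rightarrow> complex) \<Rightarrow> nat \<Rightarrow> complex" where
  "seq_scale c f = (\<lambda>n. c * f n)"

lemma vector_space_seq_scale: "vector_space seq_scale"
  by standard (auto simp: seq_scale_def fun_eq_iff algebra_simps)

end

theory Submission
  imports Defs
begin

text \<open>
  Both operators live on the Banach space \<open>c\<^sub>0\<close> of complex null sequences.  Let \<open>R\<close> and \<open>L\<close> be the
  forward and the backward shift on it and put \<open>T\<^sub>c = c L \<oplus> R \<oplus> R\<close> (\<open>shift_sum c\<close>, realized on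
  \<open>c\<^sub>0\<close> itself through the residue classes modulo 3).  Then \<open>T\<^sub>0\<close> has \<open>(UW\<^sub>\<Pi>)\<close> without
  \<open>(Z\<^sub>\<Pi>\<^sub>a)\<close>, and \<open>T\<^sub>1\<close> has \<open>(Z\<^sub>\<Pi>\<^sub>a)\<close> without \<open>(UW\<^sub>\<Pi>)\<close>.

  The summands \<open>R\<close> settle several points for both operators.  For \<open>\<bar>l\<bar> \<le> 1\<close> the operator \<open>R - l\<close>
  is injective and its range misses the first unit vector \<open>e\<close>, so \<open>T\<^sub>c - l\<close> has infinite descent; as
  the spectrum lies in the closed unit disc, there are no poles (\<open>poles_shift_sum\<close>).  If \<open>\<bar>l\<bar> = 1\<close>,
  then \<open>e\<close> nevertheless belongs to the closure of the range, so \<open>T\<^sub>c - l\<close> does not have closed range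
  (\<open>range_not_closed_on_circle\<close>) and \<open>l\<close> is in neither \<open>\<Delta>\<close> nor \<open>\<Delta>\<^sub>a\<close>.

  The zero summand of \<open>T\<^sub>0\<close> has infinite-dimensional kernel, which keeps 0 out of \<open>\<Delta>\<close> and \<open>\<Delta>\<^sub>a\<close>.  Still 0
  is a left pole: the ascent is 1 and the square has closed range.  At the other points of the open
  disc \<open>T\<^sub>0 - l\<close> is bounded below.  Hence \<open>\<Delta>\<^sub>a\<close> is empty, like the set of poles, while
  \<open>\<Delta>\<close> differs from the set of left poles at 0.

  For \<open>T\<^sub>1\<close> and \<open>\<bar>l\<bar> < 1\<close> the operator \<open>L - l\<close> is onto with one-dimensional kernel, which makes the
  ascent of \<open>T\<^sub>1 - l\<close> infinite (\<open>ascent_shift_sum_minus_1\<close>) and its nullity 1, whereas the two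
  copies of \<open>R\<close> make the deficiency at least 2.  So the index is negative and \<open>\<Delta>\<close> is empty.  There are
  no left poles either: on the unit circle \<open>T\<^sub>1 - l\<close> is injective, so that the range of its first power
  would have to be closed.  But \<open>T\<^sub>1\<close> has closed range, so 0 is in \<open>\<Delta>\<^sub>a\<close> without being a pole.
\<close>

section \<open>Operators on complex normed spaces\<close>

context complex_normed_space
begin

lemma mdist_eq: "x \<in> X \<Longrightarrow> y \<in> X \<Longrightarrow> mdist x y = nrm (x - y)"
  by (simp add: mdist_def)

lemma zero_in_X: "0 \<in> X"
  by (rule subspace_0[OF subspace_X])

lemma edim_le_card:
  assumes "finite B" "S \<subseteq> span B"
  shows "edim S \<le> enat (card B)"
  using assms dim_le_card[of S B] by (auto simp: edim_def)

lemma edim_eq_infinity: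
  assumes "independent B" "infinite B" "B \<subseteq> S"
  shows "edim S = \<infinity>"
proof -
  have "\<not> S \<subseteq> span C" if "finite C" for C
    using independent_span_bound[OF that assms(1)] assms(2,3) by auto
  then show ?thesis
    by (auto simp: edim_def)
qed

text \<open>
  If \<open>B\<close> is linearly independent modulo \<open>W\<close> and \<open>U\<close> is an algebraic complement of \<open>W\<close>, then the
  \<open>U\<close>-components of the vectors in \<open>B\<close> are distinct and linearly independent, which bounds the
  dimension of \<open>U\<close> from below.
\<close>

lemma card_le_codim:
  assumes W: "subspace W" and fin: "finite B" and BX: "B \<subseteq> X"
    and indep: "\<And>a. (\<Sum>b\<in>B. scale (a b) b) \<in> W \<Longrightarrow> \<forall>b\<in>B. a b = 0"
  shows "enat (card B) \<le> codim W"
proof -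
  have "enat (card B) \<le> edim U"
    if U: "subspace U" and sum: "{u + w |u w. u \<in> U \<and> w \<in> W} = X" for U
  proof (cases "\<exists>C. finite C \<and> U \<subseteq> span C")
    case False
    then have "edim U = \<infinity>" unfolding edim_def by (rule if_not_P)
    then show ?thesis by simp
  next
    case True
    then obtain C where C: "finite C" "U \<subseteq> span C" by blast
    have "\<forall>b\<in>B. \<exists>u. u \<in> U \<and> b - u \<in> W"
    proof
      fix b assume "b \<in> B"
      then have "b \<in> {u + w |u w. u \<in> U \<and> w \<in> W}"
        using BX sum by blast
      then obtain u w where "b = u + w" "u \<in> U" "w \<in> W" by blast
      then show "\<exists>u. u \<in> U \<and> b - u \<in> W" by (intro exI[of _ u]) simp
    qed
    then obtain u where u: "\<And>b. b \<in> B \<Longrightarrow> u b \<in> U" "\<And>b. b \<in> B \<Longrightarrow> b - u b \<in> W"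
      by metis
    have zero: "\<forall>b\<in>B. a b = 0" if "(\<Sum>b\<in>B. scale (a b) (u b)) = 0" for a
    proof (rule indep)
      have "(\<Sum>b\<in>B. scale (a b) (b - u b)) \<in> W"
        by (intro subspace_sum[OF W] subspace_scale[OF W] u)
      then show "(\<Sum>b\<in>B. scale (a b) b) \<in> W"
        using that by (simp add: scale_right_diff_distrib sum_subtractf)
    qed
    have inj: "inj_on u B"
    proof (rule inj_onI, rule ccontr)
      fix b c assume bc: "b \<in> B" "c \<in> B" "u b = u c" "b \<noteq> c"
      \<comment> \<open>the coefficients of the vanishing combination \<open>u b - u c\<close>\<close>
      define a where "a = (\<lambda>d. if d = b then 1 else if d = c then -1 else 0 :: complex)"
      have "(\<Sum>d\<in>B. scale (a d) (u d)) = (\<Sum>d\<in>{b, c}. scale (a d) (u d))"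
        using bc fin by (intro sum.mono_neutral_right) (auto simp: a_def)
      also have "\<dots> = 0"
        using bc by (simp add: a_def)
      finally have "a b = 0"
        using zero bc(1) by blast
      then show False by (simp add: a_def)
    qed
    have "independent (u ` B)"
    proof (subst dependent_finite)
      show "finite (u ` B)" using fin by simp
      show "\<not> (\<exists>a. (\<exists>v\<in>u ` B. a v \<noteq> 0) \<and> (\<Sum>v\<in>u ` B. scale (a v) v) = 0)"
        using zero[of "\<lambda>b. a (u b)" for a] by (fastforce simp: sum.reindex[OF inj])
    qed
    moreover obtain D where D: "D \<subseteq> U" "independent D" "U \<subseteq> span D" "card D = dim U"
      by (rule basis_exists)
    moreover have "finite D"
      using independent_span_bound[OF C(1) D(2)] D(1) C(2) by auto
    ultimately have "card (u ` B) \<le> dim U"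
      using independent_span_bound[of D "u ` B"] u(1) by auto
    then show ?thesis
      using True card_image[OF inj] by (auto simp: edim_def)
  qed
  then show ?thesis
    unfolding codim_def by (intro Inf_greatest) auto
qed

lemma bounded_operator_shifted:
  assumes "bounded_operator T" "x \<in> X"
  shows "shifted T l x \<in> X"
  using assms by (simp add: bounded_operator_def shifted_def subspace_diff subspace_scale subspace_X)

lemma shifted_add:
  assumes "bounded_operator T" "x \<in> X" "y \<in> X"
  shows "shifted T l (x + y) = shifted T l x + shifted T l y"
  using assms by (simp add: bounded_operator_def shifted_def scale_right_distrib)

lemma shifted_scale:
  assumes "bounded_operator T" "x \<in> X"
  shows "shifted T l (scale c x) = scale c (shifted T l x)"
  using assms by (simp add: bounded_operator_def shifted_def scale_right_diff_distrib scale_left_commute)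

lemma shifted_diff:
  assumes "bounded_operator T" "x \<in> X" "y \<in> X"
  shows "shifted T l (x - y) = shifted T l x - shifted T l y"
  using shifted_add[OF assms(1) subspace_diff[OF subspace_X assms(2,3)] assms(3), of l] by simp

lemma subspace_range_shifted:
  assumes "bounded_operator T"
  shows "subspace (range_space (shifted T l))"
  unfolding range_space_def
proof (rule subspaceI)
  have "shifted T l 0 = 0"
    using shifted_diff[OF assms zero_in_X zero_in_X] by simp
  then show "0 \<in> shifted T l ` X"
    using zero_in_X by (metis image_eqI)
next
  fix x y assume "x \<in> shifted T l ` X" "y \<in> shifted T l ` X"
  then obtain u v where "u \<in> X" "v \<in> X" "x = shifted T l u" "y = shifted T l v" by blast
  then show "x + y \<in> shifted T l ` X"
    by (intro image_eqI[of _ _ "u + v"])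
      (simp_all add: shifted_add[OF assms] subspace_add[OF subspace_X])
next
  fix c x assume "x \<in> shifted T l ` X"
  then obtain u where "u \<in> X" "x = shifted T l u" by blast
  then show "scale c x \<in> shifted T l ` X"
    by (intro image_eqI[of _ _ "scale c u"])
      (simp_all add: shifted_scale[OF assms] subspace_scale[OF subspace_X])
qed

lemma bounded_below_not_approximate_point_spectrum:
  assumes "0 < c" "\<And>x. x \<in> X \<Longrightarrow> c * nrm x \<le> nrm (shifted T l x)"
  shows "l \<notin> approximate_point_spectrum T"
proof
  assume "l \<in> approximate_point_spectrum T"
  then obtain x :: "nat \<Rightarrow> 'a" where x: "\<And>n. x n \<in> X" "\<And>n. nrm (x n) = 1"
    and lim: "(\<lambda>n. nrm (shifted T l (x n))) \<longlonglongrightarrow> 0"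
    by (auto simp: approximate_point_spectrum_def)
  have "c \<le> 0"
    using lim by (rule LIMSEQ_le_const) (use assms(2)[OF x(1)] x(2) in auto)
  then show False using assms(1) by simp
qed

lemma eigenvalue_in_approximate_point_spectrum:
  assumes "bounded_operator T" "x \<in> X" "x \<noteq> 0" "shifted T l x = 0"
  shows "l \<in> approximate_point_spectrum T"
proof -
  define y where "y = scale (1 / complex_of_real (nrm x)) x"
  have pos: "0 < nrm x"
    using nrm_nonneg nrm_eq_0_iff assms(2,3) by (metis less_eq_real_def)
  have "y \<in> X"
    by (simp add: y_def assms(2) subspace_scale[OF subspace_X])
  moreover have "nrm y = 1"
    using pos assms(2) by (simp add: y_def nrm_scale norm_divide)
  moreover have "nrm (shifted T l y) = 0"
    using assms zero_in_X nrm_eq_0_iff by (simp add: y_def shifted_scale)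
  ultimately show ?thesis
    unfolding approximate_point_spectrum_def by (intro CollectI exI[of _ "\<lambda>_. y"]) simp
qed

lemma shifted_bounded_below:
  assumes T: "bounded_operator T" and K: "\<And>x. x \<in> X \<Longrightarrow> nrm (T x) \<le> K * nrm x" and x: "x \<in> X"
  shows "(cmod l - K) * nrm x \<le> nrm (shifted T l x)"
proof -
  have mem: "T x \<in> X" "shifted T l x \<in> X"
    using bounded_operator_shifted[OF T x] T x by (auto simp: bounded_operator_def)
  have "cmod l * nrm x = nrm (T x + scale (-1) (shifted T l x))"
    using x by (simp add: shifted_def nrm_scale)
  also have "\<dots> \<le> nrm (T x) + nrm (shifted T l x)"
    using nrm_triangle[OF mem(1) subspace_scale[OF subspace_X mem(2), of "-1"]]
      nrm_scale[OF mem(2), of "-1"] by simp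
  finally show ?thesis
    using K[OF x] by (simp add: algebra_simps)
qed

lemma ascent_eq_0:
  assumes "\<And>x. x \<in> X \<Longrightarrow> T x = 0 \<Longrightarrow> x = 0" "T 0 = 0"
  shows "ascent T = 0"
proof -
  have "null_space (T ^^ 0) = null_space (T ^^ (0 + 1))"
    using assms zero_in_X by (auto simp: null_space_def)
  then have "ascent T \<le> enat 0"
    unfolding ascent_def by (intro Inf_lower) blast
  then show ?thesis by (simp flip: zero_enat_def)
qed

text \<open>
  A preimage of \<open>v\<close> under \<open>T ^^ n\<close> is annihilated by \<open>T ^^ (n + 1)\<close> but not by \<open>T ^^ n\<close>, so no two
  consecutive kernels agree.
\<close>

lemma ascent_eq_infinity:
  assumes "v \<noteq> 0" "T v = 0" and root: "\<And>n. \<exists>x\<in>X. (T ^^ n) x = v"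
  shows "ascent T = \<infinity>"
proof -
  have "null_space (T ^^ n) \<noteq> null_space (T ^^ (n + 1))" for n
  proof -
    obtain x where "x \<in> X" "(T ^^ n) x = v"
      using root by blast
    then have "x \<in> null_space (T ^^ (n + 1)) - null_space (T ^^ n)"
      using assms(1,2) by (simp add: null_space_def)
    then show ?thesis by blast
  qed
  then show ?thesis
    by (auto simp: ascent_def top_enat_def)
qed

end

context complex_banach_space
begin

text \<open>
  Solving \<open>T x - l x = y\<close> amounts to finding a fixed point of \<open>x \<mapsto> (T x - y) / l\<close>, which
  is a contraction with factor \<open>K / \<bar>l\<bar>\<close>.
\<close>

lemma shifted_surjective:
  assumes T: "bounded_operator T" and K: "\<And>x. x \<in> X \<Longrightarrow> nrm (T x) \<le> K * nrm x"
    and l: "K < cmod l" "l \<noteq> 0" and y: "y \<in> X"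
  shows "\<exists>x\<in>X. shifted T l x = y"
proof -
  define f where "f = (\<lambda>x. scale (1 / l) (T x - y))"
  have TX: "T x \<in> X" if "x \<in> X" for x
    using T that by (simp add: bounded_operator_def)
  have fX: "f x \<in> X" if "x \<in> X" for x
    using TX that y by (simp add: f_def subspace_scale subspace_diff subspace_X)
  have contr: "mdist (f x) (f z) \<le> (K / cmod l) * mdist x z" if xz: "x \<in> X" "z \<in> X" for x z
  proof -
    have "T x - T z = T (x - z)"
      using shifted_diff[OF T xz, of 0] by (simp add: shifted_def)
    then have "f x - f z = scale (1 / l) (T (x - z))"
      by (simp add: f_def scale_right_diff_distrib [symmetric])
    then have "nrm (f x - f z) = (1 / cmod l) * nrm (T (x - z))"
      using xz TX subspace_diff[OF subspace_X] by (simp add: nrm_scale norm_divide)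
    also have "\<dots> \<le> (1 / cmod l) * (K * nrm (x - z))"
      using xz K subspace_diff[OF subspace_X] by (intro mult_left_mono) auto
    finally show ?thesis
      using xz fX by (simp add: mdist_eq)
  qed
  have "X \<noteq> {}" "f \<in> X \<rightarrow> X" "K / cmod l < 1"
    using zero_in_X fX l by (auto simp: field_simps)
  from Banach_fixedpoint_thm[OF complete this contr]
  obtain x where x: "x \<in> X" "f x = x" by blast
  have "scale l x = scale l (f x)" using x by simp
  also have "\<dots> = T x - y" using l by (simp add: f_def)
  finally show ?thesis
    using x by (intro bexI[of _ x]) (auto simp: shifted_def)
qed

text \<open>
  Under this hypothesis \<open>T - l\<close> is onto and also bounded below by \<open>\<bar>l\<bar> - K\<close>, and that lower bound
  makes its inverse bounded.
\<close>

lemma not_in_spectrum_of_bound_less: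
  assumes T: "bounded_operator T" and K: "\<And>x. x \<in> X \<Longrightarrow> nrm (T x) \<le> K * nrm x"
    and l: "K < cmod l" "l \<noteq> 0"
  shows "l \<notin> spectrum T"
proof -
  let ?A = "shifted T l"
  have below: "(cmod l - K) * nrm x \<le> nrm (?A x)" if "x \<in> X" for x
    by (rule shifted_bounded_below[OF T K that])
  have inj: "x = z" if "x \<in> X" "z \<in> X" "?A x = ?A z" for x z
  proof -
    have "?A (x - z) = 0" "x - z \<in> X"
      using that shifted_diff[OF T] subspace_diff[OF subspace_X] by auto
    then have "(cmod l - K) * nrm (x - z) \<le> 0"
      using below[of "x - z"] nrm_eq_0_iff[OF zero_in_X] by simp
    then have "nrm (x - z) = 0"
      using l nrm_nonneg[OF \<open>x - z \<in> X\<close>] by (simp add: mult_le_0_iff)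
    then show ?thesis
      using nrm_eq_0_iff[OF \<open>x - z \<in> X\<close>] by simp
  qed
  define S where "S = inv_into X ?A"
  have bij: "bij_betw ?A X X"
    unfolding bij_betw_def
  proof
    show "inj_on ?A X" by (rule inj_onI) (rule inj)
    have "y \<in> ?A ` X" if "y \<in> X" for y
      using shifted_surjective[OF T K l that] by blast
    moreover have "?A x \<in> X" if "x \<in> X" for x
      by (rule bounded_operator_shifted[OF T that])
    ultimately show "?A ` X = X" by blast
  qed
  have SX: "S y \<in> X" and AS: "?A (S y) = y" if "y \<in> X" for y
    using that bij by (auto simp: S_def bij_betw_def inv_into_into f_inv_into_f)
  have SA: "S (?A x) = x" if "x \<in> X" for x
    using that bij by (simp add: S_def bij_betw_def)
  have "bounded_operator S"
    unfolding bounded_operator_def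
  proof (intro conjI ballI allI exI[of _ "1 / (cmod l - K)"])
    fix x y assume xy: "x \<in> X" "y \<in> X"
    show "S x \<in> X" using xy SX by simp
    have "?A (S x + S y) = x + y"
      using xy by (simp add: shifted_add[OF T] SX AS)
    then show "S (x + y) = S x + S y"
      using SA[OF subspace_add[OF subspace_X SX[OF xy(1)] SX[OF xy(2)]]] by simp
    have "?A (scale c (S x)) = scale c x" for c
      using xy by (simp add: shifted_scale[OF T] SX AS)
    then show "S (scale c x) = scale c (S x)" for c
      using SA[OF subspace_scale[OF subspace_X SX[OF xy(1)]], of c] by simp
    show "nrm (S x) \<le> 1 / (cmod l - K) * nrm x"
      using below[OF SX[OF xy(1)]] AS[OF xy(1)] l by (simp add: field_simps)
  qed
  then have "invertible_operator ?A"
    using AS SA unfolding invertible_operator_def by blast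
  then show ?thesis by (simp add: spectrum_def)
qed

end

section \<open>The Banach space of null sequences\<close>

definition c0 :: "(nat \<Rightarrow> complex) set" where
  "c0 = {x. x \<longlonglongrightarrow> 0}"

definition sup_norm :: "(nat \<Rightarrow> complex) \<Rightarrow> real" where
  "sup_norm x = (SUP n. cmod (x n))"

lemma cmod_le_sup_norm: "cmod (x n) \<le> sup_norm x" if "x \<in> c0"
proof -
  have "bounded (range x)"
    using that by (auto simp: c0_def intro: convergent_imp_bounded)
  then have "bdd_above (range (\<lambda>n. cmod (x n)))"
    by (auto simp: bounded_iff bdd_above_def)
  then show ?thesis
    unfolding sup_norm_def by (intro cSUP_upper) auto
qed

lemma sup_norm_le: "sup_norm x \<le> B" if "\<And>n. cmod (x n) \<le> B"
  unfolding sup_norm_def using that by (intro cSUP_least) auto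

lemma c0_diff: "x - y \<in> c0" if "x \<in> c0" "y \<in> c0"
  using that tendsto_diff[of x 0 sequentially y 0] by (simp add: c0_def fun_diff_def)

lemma c0_scale: "seq_scale c x \<in> c0" if "x \<in> c0"
  using that tendsto_mult[of "\<lambda>_. c" c sequentially x 0] by (simp add: c0_def seq_scale_def)

lemma c0_if: "(\<lambda>n. if P n then x n else y n) \<in> c0" if "x \<in> c0" "y \<in> c0"
proof -
  have "(\<lambda>n. cmod (x n) + cmod (y n)) \<longlonglongrightarrow> 0"
    using that by (auto simp: c0_def intro!: tendsto_eq_intros)
  then have "(\<lambda>n. if P n then x n else y n) \<longlonglongrightarrow> 0"
    by (rule Lim_null_comparison[rotated]) (auto intro!: always_eventually)
  then show ?thesis by (simp add: c0_def)
qed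

lemma c0_zero: "(\<lambda>_. 0) \<in> c0"
  by (simp add: c0_def)

lemma c0_shift_left: "(\<lambda>n. x (n + k)) \<in> c0" if "x \<in> c0"
  using that unfolding c0_def by (simp add: LIMSEQ_ignore_initial_segment)

lemma c0_shift_right: "(\<lambda>n. x (n - k)) \<in> c0" if "x \<in> c0"
  using that filterlim_compose[OF _ filterlim_minus_const_nat_at_top] unfolding c0_def by auto

lemma complex_normed_space_c0: "complex_normed_space seq_scale c0 sup_norm"
proof -
  interpret vector_space seq_scale by (rule vector_space_seq_scale)
  show ?thesis
  proof
    show "subspace c0"
    proof (rule subspaceI)
      show "0 \<in> c0" using c0_zero by (simp add: zero_fun_def)
      show "x + y \<in> c0" if "x \<in> c0" "y \<in> c0" for x y
        using that tendsto_add[of x 0 sequentially y 0] by (simp add: c0_def plus_fun_def)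
      show "seq_scale c x \<in> c0" if "x \<in> c0" for c x
        using that by (rule c0_scale)
    qed
  next
    fix x assume x: "x \<in> c0"
    show "0 \<le> sup_norm x"
      using cmod_le_sup_norm[OF x, of 0] norm_ge_zero by (rule order_trans[rotated])
    show "sup_norm x = 0 \<longleftrightarrow> x = 0"
    proof
      assume "sup_norm x = 0"
      then show "x = 0"
        using cmod_le_sup_norm[OF x] by (simp add: fun_eq_iff)
    qed (simp add: sup_norm_def)
    show "sup_norm (seq_scale c x) = cmod c * sup_norm x" for c
    proof (rule antisym)
      show "sup_norm (seq_scale c x) \<le> cmod c * sup_norm x"
        by (rule sup_norm_le)
          (auto simp: seq_scale_def norm_mult intro!: mult_left_mono cmod_le_sup_norm[OF x])
      show "cmod c * sup_norm x \<le> sup_norm (seq_scale c x)"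
      proof (cases "c = 0")
        case True
        then show ?thesis
          by (simp add: sup_norm_def seq_scale_def)
      next
        case False
        have "cmod (x n) \<le> sup_norm (seq_scale c x) / cmod c" for n
          using False cmod_le_sup_norm[OF c0_scale[OF x], of c n]
          by (simp add: seq_scale_def norm_mult field_simps)
        then have "sup_norm x \<le> sup_norm (seq_scale c x) / cmod c"
          by (rule sup_norm_le)
        then show ?thesis
          using False by (simp add: field_simps)
      qed
    qed
    show "sup_norm (x + y) \<le> sup_norm x + sup_norm y" if "y \<in> c0" for y
    proof (rule sup_norm_le)
      fix n
      have "cmod ((x + y) n) \<le> cmod (x n) + cmod (y n)"
        by (simp add: norm_triangle_ineq)
      also have "\<dots> \<le> sup_norm x + sup_norm y"
        by (intro add_mono cmod_le_sup_norm x that)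
      finally show "cmod ((x + y) n) \<le> sup_norm x + sup_norm y" .
    qed
  qed
qed

text \<open>
  Completeness: a Cauchy sequence for the supremum norm converges pointwise, the convergence is
  uniform, and a uniform limit of null sequences is a null sequence.
\<close>

interpretation c0: complex_banach_space seq_scale c0 sup_norm
proof -
  interpret complex_normed_space seq_scale c0 sup_norm
    by (rule complex_normed_space_c0)
  show "complex_banach_space seq_scale c0 sup_norm"
  proof
    show mcomplete
      unfolding mcomplete_def
    proof (intro allI impI)
      fix s :: "nat \<Rightarrow> nat \<Rightarrow> complex"
      assume "MCauchy s"
      then have mem: "s m \<in> c0" for m
        by (auto simp: MCauchy_def)
      have Cauchy: "\<exists>N. \<forall>m\<ge>N. \<forall>k\<ge>N. \<forall>n. cmod (s m n - s k n) < e" if "e > 0" for e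
      proof -
        have "\<exists>N. \<forall>m k. N \<le> m \<longrightarrow> N \<le> k \<longrightarrow> mdist (s m) (s k) < e"
          using \<open>MCauchy s\<close> that by (simp add: MCauchy_def)
        then obtain N where N: "\<And>m k. N \<le> m \<Longrightarrow> N \<le> k \<Longrightarrow> mdist (s m) (s k) < e"
          by blast
        have "cmod (s m n - s k n) < e" if "N \<le> m" "N \<le> k" for m k n
          using N[OF that] cmod_le_sup_norm[OF c0_diff[OF mem mem], of m k n]
          by (simp add: mdist_def mem)
        then show ?thesis by blast
      qed
      have "convergent (\<lambda>m. s m n)" for n
      proof (rule Cauchy_convergent, rule CauchyI)
        fix e :: real assume "e > 0"
        then show "\<exists>N. \<forall>m\<ge>N. \<forall>k\<ge>N. cmod (s m n - s k n) < e"
          using Cauchy by blast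
      qed
      then obtain x where lim: "\<And>n. (\<lambda>m. s m n) \<longlonglongrightarrow> x n"
        unfolding convergent_def by metis
      have unif: "\<exists>N. \<forall>m\<ge>N. \<forall>n. cmod (s m n - x n) \<le> e" if "e > 0" for e
      proof -
        obtain N where N: "\<And>m k n. N \<le> m \<Longrightarrow> N \<le> k \<Longrightarrow> cmod (s m n - s k n) < e"
          using Cauchy[OF \<open>e > 0\<close>] by metis
        have "cmod (s m n - x n) \<le> e" if "N \<le> m" for m n
        proof (rule LIMSEQ_le_const2)
          show "(\<lambda>k. cmod (s m n - s k n)) \<longlonglongrightarrow> cmod (s m n - x n)"
            by (intro tendsto_intros lim)
          show "\<exists>K. \<forall>k\<ge>K. cmod (s m n - s k n) \<le> e"
            using N that less_imp_le by blast
        qed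
        then show ?thesis by blast
      qed
      have "x \<longlonglongrightarrow> 0"
      proof (rule LIMSEQ_I)
        fix e :: real assume "e > 0"
        then have "0 < e / 2" by simp
        from unif[OF this] obtain m where m: "\<And>n. cmod (s m n - x n) \<le> e / 2"
          by blast
        obtain K where K: "\<And>n. n \<ge> K \<Longrightarrow> cmod (s m n) < e / 2"
          using LIMSEQ_D[of "s m" 0 "e / 2"] mem[of m] \<open>e > 0\<close> by (auto simp: c0_def)
        have "cmod (x n) < e" if "n \<ge> K" for n
          using m[of n] K[OF that] norm_triangle_sub[of "x n" "s m n"]
          by (simp add: norm_minus_commute)
        then show "\<exists>K. \<forall>n\<ge>K. cmod (x n - 0) < e" by auto
      qed
      then have x: "x \<in> c0" by (simp add: c0_def)
      have "limitin mtopology s x sequentially"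
        unfolding limitin_metric
      proof (intro conjI allI impI x)
        fix e :: real assume "e > 0"
        then have "0 < e / 2" by simp
        from unif[OF this] obtain N where N: "\<And>m n. m \<ge> N \<Longrightarrow> cmod (s m n - x n) \<le> e / 2"
          by blast
        have "mdist (s m) x < e" if "m \<ge> N" for m
        proof -
          have "sup_norm (s m - x) \<le> e / 2"
            by (rule sup_norm_le) (use N[OF that] in simp)
          then show ?thesis
            using \<open>e > 0\<close> mem x by (simp add: mdist_def)
        qed
        then show "\<forall>\<^sub>F m in sequentially. s m \<in> c0 \<and> mdist (s m) x < e"
          using mem by (auto simp: eventually_sequentially)
      qed
      then show "\<exists>x. limitin mtopology s x sequentially" by blast
    qed
  qed
qed

text \<open>
  Both closed ranges needed below are spaces of null sequences that vanish on a set of indices; they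
  are closed because evaluation at an index is continuous.
\<close>

lemma closedin_c0_vanishing:
  "closedin c0.mtopology {y \<in> c0. \<forall>n\<in>A. y n = 0}" (is "closedin _ ?C")
  unfolding c0.closedin_metric
proof (intro conjI allI impI)
  fix x assume "x \<in> c0 - ?C"
  then obtain n where x: "x \<in> c0" and n: "n \<in> A" "x n \<noteq> 0" by blast
  have "y \<notin> c0.mball x (cmod (x n))" if "y \<in> ?C" for y
    using that n cmod_le_sup_norm[OF c0_diff[OF x], of y n] x
    by (auto simp: c0.in_mball c0.mdist_eq)
  then show "\<exists>r>0. disjnt ?C (c0.mball x r)"
    using n by (intro exI[of _ "cmod (x n)"]) (auto simp: disjnt_def)
qed auto

definition unit_seq :: "nat \<Rightarrow> nat \<Rightarrow> complex" where
  "unit_seq k = (\<lambda>n. if n = k then 1 else 0)"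

lemma unit_seq_in_c0: "unit_seq k \<in> c0"
proof -
  have "\<forall>\<^sub>F n in sequentially. unit_seq k n = 0"
    using eventually_gt_at_top[of k] by eventually_elim (simp add: unit_seq_def)
  then show ?thesis
    by (simp add: c0_def tendsto_eventually)
qed

lemma sum_seq_apply: "(\<Sum>v\<in>S. f v) n = (\<Sum>v\<in>S. f v n)" for f :: "'b \<Rightarrow> nat \<Rightarrow> complex"
  by (induction S rule: infinite_finite_induct) auto

lemma inj_unit_seq: "inj_on unit_seq A"
  by (rule inj_onI) (metis unit_seq_def zero_neq_one)

lemma independent_unit_seqs: "c0.independent (unit_seq ` A)"
  unfolding c0.independent_explicit_module
proof (intro allI impI)
  fix S u v
  assume S: "finite S" "S \<subseteq> unit_seq ` A" and sum: "(\<Sum>w\<in>S. seq_scale (u w) w) = 0" and v: "v \<in> S"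
  then obtain k where k: "v = unit_seq k" by blast
  have zero: "seq_scale (u w) w k = 0" if "w \<in> S - {v}" for w
  proof -
    obtain i where "w = unit_seq i" "i \<noteq> k"
      using \<open>w \<in> S - {v}\<close> S(2) k by blast
    then show ?thesis
      by (simp add: seq_scale_def unit_seq_def)
  qed
  have "0 = (\<Sum>w\<in>S. seq_scale (u w) w k)"
    using arg_cong[OF sum, of "\<lambda>f. f k"] by (simp add: sum_seq_apply)
  also have "\<dots> = seq_scale (u v) v k"
    using S(1) v zero by (simp add: sum.remove)
  also have "\<dots> = u v"
    by (simp add: k seq_scale_def unit_seq_def)
  finally show "u v = 0" by simp
qed

lemma edim_infinite_unit_seqs: "c0.edim S = \<infinity>" if "infinite A" "unit_seq ` A \<subseteq> S"
  using c0.edim_eq_infinity[OF independent_unit_seqs _ that(2)] that(1)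
  by (simp add: finite_image_iff inj_unit_seq)

lemma infinite_dimensional_c0: "c0.infinite_dimensional"
  unfolding c0.infinite_dimensional_def
  by (rule edim_infinite_unit_seqs[of UNIV]) (auto simp: unit_seq_in_c0)

section \<open>A direct sum of shifts\<close>

text \<open>
  Splitting a sequence into its restrictions to the three residue classes modulo 3 identifies
  \<open>c\<^sub>0\<close> with \<open>c\<^sub>0 \<oplus> c\<^sub>0 \<oplus> c\<^sub>0\<close>.  With \<open>R\<close> and \<open>L\<close> the forward and the backward shift on \<open>c\<^sub>0\<close>, the
  operator below is then \<open>c L \<oplus> R \<oplus> R\<close>.  There are two copies of \<open>R\<close> so that the deficiency, which is
  at least 2 in the closed unit disc, exceeds the nullity, which is at most 1 if \<open>c = 1\<close>.
\<close>

definition shift_sum :: "complex \<Rightarrow> (nat \<Rightarrow> complex) \<Rightarrow> nat \<Rightarrow> complex" where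
  "shift_sum c x = (\<lambda>n. if n mod 3 = 0 then c * x (n + 3) else if n < 3 then 0 else x (n - 3))"

abbreviation shift_sum_minus :: "complex \<Rightarrow> complex \<Rightarrow> (nat \<Rightarrow> complex) \<Rightarrow> nat \<Rightarrow> complex" where
  "shift_sum_minus c l \<equiv> c0.shifted (shift_sum c) l"

lemma shift_sum_minus_apply:
  "shift_sum_minus c l x n =
    (if n mod 3 = 0 then c * x (n + 3) else if n < 3 then 0 else x (n - 3)) - l * x n"
  by (simp add: c0.shifted_def shift_sum_def seq_scale_def)

lemma shift_sum_minus_0: "shift_sum_minus c 0 = shift_sum c"
  by (simp add: fun_eq_iff shift_sum_minus_apply shift_sum_def)

lemma shift_sum_in_c0: "shift_sum c x \<in> c0" if "x \<in> c0"
proof -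
  have "(\<lambda>n. if n mod 3 = 0 then seq_scale c (\<lambda>n. x (n + 3)) n else if n < 3 then 0 else x (n - 3)) \<in> c0"
    by (rule c0_if[OF c0_scale[OF c0_shift_left[OF that]] c0_if[OF c0_zero c0_shift_right[OF that]]])
  then show ?thesis
    unfolding shift_sum_def seq_scale_def .
qed

lemma sup_norm_shift_sum: "sup_norm (shift_sum c x) \<le> sup_norm x" if "cmod c \<le> 1" "x \<in> c0"
proof (rule sup_norm_le)
  fix n
  have "cmod (c * x (n + 3)) \<le> 1 * sup_norm x"
    unfolding norm_mult using that by (intro mult_mono cmod_le_sup_norm) auto
  moreover have "0 \<le> sup_norm x"
    by (rule c0.nrm_nonneg[OF that(2)])
  ultimately show "cmod (shift_sum c x n) \<le> sup_norm x"
    using cmod_le_sup_norm[OF that(2)] by (simp add: shift_sum_def)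
qed

lemma bounded_operator_shift_sum: "c0.bounded_operator (shift_sum c)" if "cmod c \<le> 1"
  unfolding c0.bounded_operator_def
proof (intro conjI ballI allI exI[of _ 1])
  fix x assume x: "x \<in> c0"
  show "shift_sum c x \<in> c0" using x by (rule shift_sum_in_c0)
  show "shift_sum c (x + y) = shift_sum c x + shift_sum c y" for y
    by (auto simp: fun_eq_iff shift_sum_def algebra_simps)
  show "shift_sum c (seq_scale a x) = seq_scale a (shift_sum c x)" for a
    by (auto simp: fun_eq_iff shift_sum_def seq_scale_def)
  show "sup_norm (shift_sum c x) \<le> 1 * sup_norm x"
    using sup_norm_shift_sum[OF that x] by simp
qed

lemma not_in_spectrum_outside_disc: "l \<notin> c0.spectrum (shift_sum c)" if "cmod c \<le> 1" "1 < cmod l"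
proof (rule c0.not_in_spectrum_of_bound_less)
  show "sup_norm (shift_sum c x) \<le> 1 * sup_norm x" if "x \<in> c0" for x
    using sup_norm_shift_sum[OF \<open>cmod c \<le> 1\<close> that] by simp
  show "c0.bounded_operator (shift_sum c)"
    by (rule bounded_operator_shift_sum[OF that(1)])
qed (use that in auto)

lemma not_in_approximate_point_spectrum_outside_disc:
  "l \<notin> c0.approximate_point_spectrum (shift_sum c)" if "cmod c \<le> 1" "1 < cmod l"
proof (rule c0.bounded_below_not_approximate_point_spectrum)
  show "0 < cmod l - 1" using that by simp
  show "(cmod l - 1) * sup_norm x \<le> sup_norm (shift_sum_minus c l x)" if x: "x \<in> c0" for x
  proof (rule c0.shifted_bounded_below[OF bounded_operator_shift_sum[OF \<open>cmod c \<le> 1\<close>] _ x])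
    show "sup_norm (shift_sum c z) \<le> 1 * sup_norm z" if "z \<in> c0" for z
      using sup_norm_shift_sum[OF \<open>cmod c \<le> 1\<close> that] by simp
  qed
qed

lemma zero_in_approximate_point_spectrum_shift_sum:
  assumes "cmod c \<le> 1"
  shows "0 \<in> c0.approximate_point_spectrum (shift_sum c)"
proof (rule c0.eigenvalue_in_approximate_point_spectrum)
  show "c0.bounded_operator (shift_sum c)"
    by (rule bounded_operator_shift_sum[OF assms])
  show "unit_seq 0 \<in> c0"
    by (rule unit_seq_in_c0)
  show "unit_seq 0 \<noteq> 0"
    by (auto simp: fun_eq_iff unit_seq_def)
  show "shift_sum_minus c 0 (unit_seq 0) = 0"
    by (auto simp: fun_eq_iff shift_sum_minus_apply unit_seq_def)
qed

text \<open>
  Since \<open>\<bar>l\<bar> \<le> 1\<close>, the recursion makes \<open>\<bar>f\<bar>\<close> nondecreasing, and a nondecreasing null sequence of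
  nonnegative numbers is zero.
\<close>

lemma null_sequence_backward_geometric:
  fixes f :: "nat \<Rightarrow> complex"
  assumes lim: "f \<longlonglongrightarrow> 0" and rec: "\<And>k. f k = l * f (Suc k)" and l: "cmod l \<le> 1"
  shows "f 0 = 0"
proof -
  have "cmod (f 0) \<le> cmod (f k)" for k
  proof (induction k)
    case (Suc k)
    have "cmod (f k) \<le> 1 * cmod (f (Suc k))"
      unfolding rec[of k] norm_mult using l by (intro mult_right_mono) auto
    then show ?case using Suc by simp
  qed simp
  then have "cmod (f 0) \<le> 0"
    using lim by (intro LIMSEQ_le_const[of "\<lambda>k. cmod (f k)"]) (auto simp: tendsto_norm_zero)
  then show ?thesis by simp
qed

lemma c0_residue_class: "(\<lambda>k. x (3 * k + j)) \<longlonglongrightarrow> 0" if "x \<in> c0"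
  using that LIMSEQ_subseq_LIMSEQ[of x 0 "\<lambda>k. 3 * k + j"]
  by (simp add: c0_def strict_mono_def o_def)

text \<open>
  For one copy of \<open>R\<close> on null sequences this says that the range of \<open>R - l\<close> meets the line through the first unit
  vector only in 0.  If all entries of \<open>(R - l) x\<close> except possibly the first vanish, then
  \<open>x\<^sub>k = l x\<^sub>k\<^sub>+\<^sub>1\<close> for all \<open>k\<close>, hence \<open>x\<^sub>0 = 0\<close>; and the first entry is \<open>- l x\<^sub>0\<close>.
\<close>

lemma shift_sum_minus_leading_entry:
  assumes x: "x \<in> c0" and l: "cmod l \<le> 1" and j: "j = 1 \<or> j = 2"
    and zero: "\<And>k. shift_sum_minus c l x (3 * Suc k + j) = 0"
  shows "shift_sum_minus c l x j = 0"
proof -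
  have res: "(3 * k + j) mod 3 \<noteq> 0" for k
    using j by presburger
  have "x (3 * k + j) = l * x (3 * Suc k + j)" for k
    using zero[of k] res[of "Suc k"] by (simp add: shift_sum_minus_apply)
  then have "x (3 * 0 + j) = 0"
    by (rule null_sequence_backward_geometric[OF c0_residue_class[OF x] _ l])
  then show ?thesis
    using j by (auto simp: shift_sum_minus_apply)
qed

text \<open>
  For every \<open>l\<close>, the operator \<open>R - l\<close> is injective on all sequences: if \<open>l \<noteq> 0\<close>, the entries of a
  sequence can be read off recursively from its image, and \<open>R\<close> itself just moves them.
\<close>

lemma shift_sum_minus_eq_off_multiples:
  assumes eq: "\<And>n. n mod 3 \<noteq> 0 \<Longrightarrow> shift_sum_minus c l x n = shift_sum_minus c l y n" and n: "n mod 3 \<noteq> 0"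
  shows "x n = y n"
proof (cases "l = 0")
  case True
  have "(n + 3) mod 3 \<noteq> 0" using n by simp
  then show ?thesis
    using eq[of "n + 3"] True by (simp add: shift_sum_minus_apply)
next
  case False
  show ?thesis
    using n
  proof (induction n rule: less_induct)
    case (less n)
    have "x (n - 3) = y (n - 3)" if "\<not> n < 3"
    proof (rule less.IH)
      show "n - 3 < n" using that by simp
      show "(n - 3) mod 3 \<noteq> 0" using that less.prems by presburger
    qed
    then show ?case
      using eq[OF less.prems] less.prems False by (simp add: shift_sum_minus_apply split: if_splits)
  qed
qed

lemma shift_sum_minus_power_eq_off_multiples:
  assumes "\<And>n. n mod 3 \<noteq> 0 \<Longrightarrow> (shift_sum_minus c l ^^ p) x n = (shift_sum_minus c l ^^ p) y n"
    and "n mod 3 \<noteq> 0"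
  shows "x n = y n"
  using assms
proof (induction p arbitrary: x y n)
  case (Suc p)
  have "shift_sum_minus c l x m = shift_sum_minus c l y m" if "m mod 3 \<noteq> 0" for m
    by (rule Suc.IH[OF _ that]) (use Suc.prems(1) in \<open>simp add: funpow_swap1\<close>)
  then show ?case
    using Suc.prems(2) by (rule shift_sum_minus_eq_off_multiples)
qed simp

lemma unit_seq_1_not_in_range:
  assumes x: "x \<in> c0" and l: "cmod l \<le> 1"
  shows "\<exists>n. n mod 3 \<noteq> 0 \<and> unit_seq 1 n \<noteq> shift_sum_minus c l x n"
proof (rule ccontr)
  assume "\<not> ?thesis"
  then have eq: "shift_sum_minus c l x n = unit_seq 1 n" if "n mod 3 \<noteq> 0" for n
    using that by metis
  have "shift_sum_minus c l x (3 * Suc k + 1) = 0" for k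
    using eq[of "3 * Suc k + 1"] by (simp add: unit_seq_def mod_Suc)
  then have "shift_sum_minus c l x 1 = 0"
    by (rule shift_sum_minus_leading_entry[OF x l, rotated]) simp
  then show False
    using eq[of 1] by (simp add: unit_seq_def)
qed

text \<open>
  If the ranges of \<open>A ^^ p\<close> and \<open>A ^^ (p + 1)\<close> agreed, injectivity on the residue classes 1 and 2
  would allow cancelling \<open>A ^^ p\<close> there and put the first unit vector into the range of \<open>R - l\<close>.
\<close>

lemma descent_shift_sum_minus: "c0.descent (shift_sum_minus c l) = \<infinity>" if l: "cmod l \<le> 1"
proof -
  let ?A = "shift_sum_minus c l"
  have "c0.range_space (?A ^^ p) \<noteq> c0.range_space (?A ^^ (p + 1))" for p
  proof
    assume "c0.range_space (?A ^^ p) = c0.range_space (?A ^^ (p + 1))"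
    then have "(?A ^^ p) (unit_seq 1) \<in> (?A ^^ (p + 1)) ` c0"
      using unit_seq_in_c0 unfolding c0.range_space_def by blast
    then obtain x where x: "x \<in> c0" and eq: "(?A ^^ p) (unit_seq 1) = (?A ^^ p) (?A x)"
      by (auto simp: funpow_swap1)
    have "unit_seq 1 n = ?A x n" if "n mod 3 \<noteq> 0" for n
      by (rule shift_sum_minus_power_eq_off_multiples[OF _ that, of p c l]) (simp only: eq)
    then show False
      using unit_seq_1_not_in_range[OF x l] by blast
  qed
  then show ?thesis
    by (auto simp: c0.descent_def top_enat_def)
qed

text \<open>
  A pole would have to lie outside the closed disc because of its finite descent, but there is no
  spectrum there.
\<close>

lemma poles_shift_sum: "c0.poles (shift_sum c) = {}" if "cmod c \<le> 1"
proof -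
  have "l \<notin> c0.poles (shift_sum c)" for l
  proof (cases "cmod l \<le> 1")
    case True
    then show ?thesis by (simp add: c0.poles_def descent_shift_sum_minus)
  next
    case False
    then show ?thesis
      using not_in_spectrum_outside_disc[OF that, of l] by (simp add: c0.poles_def)
  qed
  then show ?thesis by blast
qed

definition geometric_seq :: "nat \<Rightarrow> complex \<Rightarrow> nat \<Rightarrow> complex" where
  "geometric_seq j r = (\<lambda>n. if n mod 3 = j then r ^ (n div 3) else 0)"

lemma geometric_seq_in_c0: "geometric_seq j r \<in> c0" if "cmod r < 1"
proof -
  have "(\<lambda>n. r ^ (n div 3)) \<longlonglongrightarrow> 0"
    by (rule filterlim_compose[OF LIMSEQ_power_zero[OF that]])
      (simp add: filterlim_at_top_div_const_nat)
  then have "(\<lambda>n. r ^ (n div 3)) \<in> c0"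
    by (simp add: c0_def)
  then show ?thesis
    unfolding geometric_seq_def by (intro c0_if c0_zero)
qed

text \<open>
  The first unit vector \<open>e\<close> is not in the range of \<open>R - l\<close>, but it is in the closure: for \<open>\<bar>q\<bar> < 1\<close> the
  null sequence \<open>w = (- q ^ (k + 1))\<^sub>k\<close>, which is \<open>(R - 1 / q)\<^bsup>-1\<^esup> e\<close> if \<open>q \<noteq> 0\<close>, has
  \<open>e - (R - l) w = (1 - l q) (q ^ k)\<^sub>k\<close>, and the norm \<open>\<bar>1 - l q\<bar>\<close> of this tends to 0 as \<open>q\<close>
  approaches \<open>1 / l\<close> radially.
\<close>

lemma range_not_closed_on_circle:
  assumes c: "cmod c \<le> 1" and l: "cmod l = 1"
  shows "\<not> closedin c0.mtopology (c0.range_space (shift_sum_minus c l))"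
proof
  assume "closedin c0.mtopology (c0.range_space (shift_sum_minus c l))"
  moreover have "unit_seq 1 \<in> c0 - c0.range_space (shift_sum_minus c l)"
    using unit_seq_in_c0 unit_seq_1_not_in_range[of _ l c] l
    by (force simp: c0.range_space_def)
  ultimately obtain r where r: "r > 0"
    and disj: "disjnt (c0.range_space (shift_sum_minus c l)) (c0.mball (unit_seq 1) r)"
    by (auto simp: c0.closedin_metric)
  define e where "e = min (r / 2) (1 / 2)"
  have e: "0 < e" "e < 1" "e < r"
    using r by (auto simp: e_def)
  define q where "q = complex_of_real (1 - e) / l"
  have q: "cmod q < 1"
    unfolding q_def norm_divide norm_of_real using e l by simp
  have "l \<noteq> 0" using l by auto
  then have lq: "l * q = 1 - complex_of_real e"
    by (simp add: q_def)
  define w where "w = seq_scale (- q) (geometric_seq 1 q)"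
  have w: "w \<in> c0"
    unfolding w_def by (intro c0_scale geometric_seq_in_c0 q)
  have diff: "unit_seq 1 - shift_sum_minus c l w = seq_scale e (geometric_seq 1 q)"
  proof
    fix n :: nat
    consider "n mod 3 \<noteq> 1" | "n = 1" | k where "n = 3 * k + 4"
    proof -
      have "n mod 3 \<noteq> 1 \<or> n = 1 \<or> (\<exists>k. n = 3 * k + 4)" by presburger
      then show thesis using that by blast
    qed
    then show "(unit_seq 1 - shift_sum_minus c l w) n = seq_scale e (geometric_seq 1 q) n"
    proof cases
      case 1
      then have "(n + 3) mod 3 \<noteq> 1" "n \<noteq> 1" "\<not> n < 3 \<Longrightarrow> (n - 3) mod 3 \<noteq> 1"
        by presburger+
      then show ?thesis
        using 1 by (simp add: shift_sum_minus_apply w_def seq_scale_def geometric_seq_def unit_seq_def)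
    next
      case 2
      then show ?thesis
        using lq by (simp add: shift_sum_minus_apply w_def seq_scale_def geometric_seq_def unit_seq_def)
    next
      case (3 k)
      have "n - 3 = 1 + 3 * k"
        using 3 by simp
      then have "(n - 3) mod 3 = 1" "(n - 3) div 3 = k"
        by simp_all
      moreover have "n mod 3 = 1" "n div 3 = Suc k" "\<not> n < 3" "n \<noteq> 1"
        using 3 by presburger+
      ultimately have "(unit_seq 1 - shift_sum_minus c l w) n = q * q ^ k - (l * q) * q ^ Suc k"
        by (simp add: shift_sum_minus_apply w_def seq_scale_def geometric_seq_def unit_seq_def)
      also have "\<dots> = e * q ^ Suc k"
        by (simp add: lq algebra_simps)
      finally show ?thesis
        using \<open>n mod 3 = 1\<close> \<open>n div 3 = Suc k\<close> by (simp add: seq_scale_def geometric_seq_def)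
    qed
  qed
  have "sup_norm (unit_seq 1 - shift_sum_minus c l w) \<le> e"
    unfolding diff
  proof (rule sup_norm_le)
    fix n
    have "cmod (geometric_seq 1 q n) \<le> 1"
      using q by (simp add: geometric_seq_def norm_power power_le_one)
    then have "e * cmod (geometric_seq 1 q n) \<le> e * 1"
      using e by (intro mult_left_mono) auto
    then show "cmod (seq_scale e (geometric_seq 1 q) n) \<le> e"
      using e by (simp add: seq_scale_def norm_mult)
  qed
  moreover have "shift_sum_minus c l w \<in> c0"
    by (rule c0.bounded_operator_shifted[OF bounded_operator_shift_sum[OF c] w])
  ultimately have "shift_sum_minus c l w \<in> c0.mball (unit_seq 1) r"
    unfolding c0.in_mball using e unit_seq_in_c0[of 1] by (simp add: c0.mdist_eq)
  then show False
    using disj imageI[OF w, of "shift_sum_minus c l"] unfolding disjnt_iff c0.range_space_def by blast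
qed

section \<open>The operator with a zero summand\<close>

lemma nullity_shift_sum_0: "c0.nullity (shift_sum 0) = \<infinity>"
  unfolding c0.nullity_def
proof (rule edim_infinite_unit_seqs)
  show "infinite (range (\<lambda>k. 3 * k :: nat))"
    by (rule range_inj_infinite) (simp add: inj_def)
  have "shift_sum 0 (unit_seq (3 * k)) n = 0" for k n
  proof -
    have "n - 3 \<noteq> 3 * k" if "n mod 3 \<noteq> 0" "\<not> n < 3"
      using that by presburger
    then show ?thesis
      by (simp add: shift_sum_def unit_seq_def)
  qed
  then show "unit_seq ` range (\<lambda>k. 3 * k) \<subseteq> c0.null_space (shift_sum 0)"
    by (auto simp: c0.null_space_def unit_seq_in_c0 fun_eq_iff)
qed

text \<open>
  On the multiples of 3 the operator is \<open>- l\<close>.  On the other residue classes it is \<open>R - l\<close> with \<open>R\<close> an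
  isometry, which is bounded below by \<open>1 - \<bar>l\<bar>\<close>.
\<close>

lemma bounded_below_shift_sum_0:
  assumes l: "l \<noteq> 0" "cmod l < 1" and x: "x \<in> c0"
  shows "min (cmod l) (1 - cmod l) * sup_norm x \<le> sup_norm (shift_sum_minus 0 l x)"
proof -
  let ?y = "shift_sum_minus 0 l x"
  have y: "?y \<in> c0"
    by (rule c0.bounded_operator_shifted[OF bounded_operator_shift_sum x]) simp
  have pos: "0 < cmod l" using l by simp
  have "sup_norm x \<le> max (sup_norm ?y / cmod l) (sup_norm ?y + cmod l * sup_norm x)"
  proof (rule sup_norm_le)
    fix n
    show "cmod (x n) \<le> max (sup_norm ?y / cmod l) (sup_norm ?y + cmod l * sup_norm x)"
    proof (cases "n mod 3 = 0")
      case True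
      then have "cmod l * cmod (x n) \<le> sup_norm ?y"
        using cmod_le_sup_norm[OF y, of n] by (simp add: shift_sum_minus_apply norm_mult)
      then show ?thesis
        using pos by (simp add: le_max_iff_disj field_simps)
    next
      case False
      then have "x n = ?y (n + 3) + l * x (n + 3)"
        by (simp add: shift_sum_minus_apply)
      then have "cmod (x n) \<le> cmod (?y (n + 3)) + cmod l * cmod (x (n + 3))"
        by (metis norm_mult norm_triangle_ineq)
      also have "\<dots> \<le> sup_norm ?y + cmod l * sup_norm x"
        by (intro add_mono mult_left_mono cmod_le_sup_norm x y) simp
      finally show ?thesis by simp
    qed
  qed
  then consider "cmod l * sup_norm x \<le> sup_norm ?y" | "(1 - cmod l) * sup_norm x \<le> sup_norm ?y"
    using pos by (auto simp: le_max_iff_disj field_simps)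
  moreover have "min (cmod l) (1 - cmod l) * sup_norm x \<le> cmod l * sup_norm x"
    "min (cmod l) (1 - cmod l) * sup_norm x \<le> (1 - cmod l) * sup_norm x"
    by (intro mult_right_mono c0.nrm_nonneg x; simp)+
  ultimately show ?thesis
    by (meson order_trans)
qed

text \<open>
  Each region of the plane has its own obstruction: infinite nullity at 0, a positive lower bound elsewhere
  in the open disc and outside the closed disc, and non-closed range on the circle.
\<close>

lemma Delta_a_shift_sum_0: "c0.Delta_a (shift_sum 0) = {}"
proof -
  have "l \<notin> c0.Delta_a (shift_sum 0)" for l
  proof -
    consider "l = 0" | "l \<noteq> 0" "cmod l < 1" | "cmod l = 1" | "1 < cmod l"
      by fastforce
    then show ?thesis
    proof cases
      case 1
      then show ?thesis
        by (simp add: c0.Delta_a_def c0.upper_semi_Weyl_spectrum_def c0.upper_semi_Fredholm_def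
            shift_sum_minus_0 nullity_shift_sum_0)
    next
      case 2
      then have "l \<notin> c0.approximate_point_spectrum (shift_sum 0)"
        by (intro c0.bounded_below_not_approximate_point_spectrum[OF _ bounded_below_shift_sum_0])
          auto
      then show ?thesis by (simp add: c0.Delta_a_def)
    next
      case 3
      then show ?thesis
        using range_not_closed_on_circle[of 0 l]
        by (simp add: c0.Delta_a_def c0.upper_semi_Weyl_spectrum_def c0.upper_semi_Fredholm_def)
    next
      case 4
      then show ?thesis
        using not_in_approximate_point_spectrum_outside_disc[of 0 l] by (simp add: c0.Delta_a_def)
    qed
  qed
  then show ?thesis by blast
qed

lemma ascent_shift_sum_0: "c0.ascent (shift_sum 0) = 1"
proof -
  let ?T = "shift_sum 0"
  have "?T (unit_seq 0) = 0"
    by (auto simp: fun_eq_iff shift_sum_def unit_seq_def)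
  moreover have "unit_seq 0 \<noteq> 0"
    by (auto simp: fun_eq_iff unit_seq_def)
  ultimately have "unit_seq 0 \<in> c0.null_space (?T ^^ (0 + 1))" "unit_seq 0 \<notin> c0.null_space (?T ^^ 0)"
    by (simp_all add: c0.null_space_def unit_seq_in_c0)
  then have ne: "c0.null_space (?T ^^ 0) \<noteq> c0.null_space (?T ^^ (0 + 1))"
    by blast
  have zero: "?T 0 = 0"
    by (simp add: fun_eq_iff shift_sum_def)
  have "?T x = 0" if "?T (?T x) = 0" for x
  proof
    fix n
    have "?T x n = 0 n" if "n mod 3 \<noteq> 0"
      by (rule shift_sum_minus_eq_off_multiples[of 0 0 "?T x" 0, OF _ that])
        (simp add: shift_sum_minus_0 \<open>?T (?T x) = 0\<close> zero)
    then show "?T x n = 0 n"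
      by (cases "n mod 3 = 0") (simp_all add: shift_sum_def)
  qed
  with zero have eq: "c0.null_space (?T ^^ 1) = c0.null_space (?T ^^ (1 + 1))"
    by (auto simp: c0.null_space_def)
  show ?thesis
    unfolding c0.ascent_def
  proof (rule antisym)
    show "Inf {enat n |n. c0.null_space (?T ^^ n) = c0.null_space (?T ^^ (n + 1))} \<le> 1"
      using eq by (intro Inf_lower) (auto simp: one_enat_def)
    show "1 \<le> Inf {enat n |n. c0.null_space (?T ^^ n) = c0.null_space (?T ^^ (n + 1))}"
    proof (rule Inf_greatest)
      fix a assume "a \<in> {enat n |n. c0.null_space (?T ^^ n) = c0.null_space (?T ^^ (n + 1))}"
      then obtain n where n: "a = enat n" "c0.null_space (?T ^^ n) = c0.null_space (?T ^^ (n + 1))"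
        by blast
      then have "n \<noteq> 0" using ne by metis
      then show "1 \<le> a" using n(1) by (simp add: one_enat_def)
    qed
  qed
qed

lemma range_shift_sum_0_squared:
  "c0.range_space (shift_sum 0 ^^ 2) = {y \<in> c0. \<forall>n\<in>{n. n mod 3 = 0 \<or> n < 6}. y n = 0}"
proof -
  have sq: "shift_sum 0 (shift_sum 0 x) n = (if n mod 3 = 0 \<or> n < 6 then 0 else x (n - 6))" for x n
  proof -
    have "(n - 3) mod 3 \<noteq> 0" if "n mod 3 \<noteq> 0" "\<not> n < 3"
      using that by presburger
    then show ?thesis by (auto simp: shift_sum_def)
  qed
  show ?thesis
  proof (intro equalityI subsetI)
    fix y assume "y \<in> c0.range_space (shift_sum 0 ^^ 2)"
    then obtain x where "x \<in> c0" "y = shift_sum 0 (shift_sum 0 x)"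
      by (auto simp: c0.range_space_def numeral_2_eq_2)
    then show "y \<in> {y \<in> c0. \<forall>n\<in>{n. n mod 3 = 0 \<or> n < 6}. y n = 0}"
      by (auto simp: shift_sum_in_c0 sq)
  next
    fix y assume y: "y \<in> {y \<in> c0. \<forall>n\<in>{n. n mod 3 = 0 \<or> n < 6}. y n = 0}"
    then have "y = shift_sum 0 (shift_sum 0 (\<lambda>n. y (n + 6)))"
      by (auto simp: fun_eq_iff sq)
    moreover have "(\<lambda>n. y (n + 6)) \<in> c0"
      using y by (intro c0_shift_left) simp
    ultimately show "y \<in> c0.range_space (shift_sum 0 ^^ 2)"
      unfolding c0.range_space_def by (intro image_eqI[of _ _ "\<lambda>n. y (n + 6)"]) (auto simp: numeral_2_eq_2)
  qed
qed

lemma zero_in_left_poles_shift_sum_0: "0 \<in> c0.left_poles (shift_sum 0)"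
proof -
  have "0 \<in> c0.approximate_point_spectrum (shift_sum 0)"
    by (rule zero_in_approximate_point_spectrum_shift_sum) simp
  moreover have "closedin c0.mtopology (c0.range_space (shift_sum 0 ^^ (1 + 1)))"
    unfolding one_add_one range_shift_sum_0_squared by (rule closedin_c0_vanishing)
  ultimately show ?thesis
    unfolding c0.left_poles_def mem_Collect_eq shift_sum_minus_0 ascent_shift_sum_0 one_enat_def
    by blast
qed

lemma property_UW_Pi_shift_sum_0: "c0.property_UW_Pi (shift_sum 0)"
  by (simp add: c0.property_UW_Pi_def Delta_a_shift_sum_0 poles_shift_sum)

lemma not_property_Z_Pi_a_shift_sum_0: "\<not> c0.property_Z_Pi_a (shift_sum 0)"
proof -
  have "0 \<notin> c0.Delta (shift_sum 0)"
    by (simp add: c0.Delta_def c0.Weyl_spectrum_def c0.Fredholm_def c0.upper_semi_Fredholm_def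
        shift_sum_minus_0 nullity_shift_sum_0)
  then show ?thesis
    using zero_in_left_poles_shift_sum_0 by (auto simp: c0.property_Z_Pi_a_def)
qed

section \<open>The operator with a backward shift as a summand\<close>

text \<open>
  On the multiples of 3, where \<open>shift_sum 1\<close> acts as the backward shift \<open>L\<close> with right inverse
  the forward shift \<open>R\<close>, a solution of \<open>x = R (l x + y)\<close> satisfies \<open>L x = l x + y\<close>.  A solution exists
  because \<open>l R\<close> has norm less than 1.
\<close>

lemma shift_sum_minus_1_onto_multiples:
  assumes l: "cmod l < 1" and y: "y \<in> c0" and supp: "\<And>n. n mod 3 \<noteq> 0 \<Longrightarrow> y n = 0"
  obtains x where "x \<in> c0" "\<And>n. n mod 3 \<noteq> 0 \<Longrightarrow> x n = 0" "shift_sum_minus 1 l x = y"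
proof -
  define R where "R = (\<lambda>(x :: nat \<Rightarrow> complex) n. if n mod 3 = 0 \<and> 3 \<le> n then x (n - 3) else 0)"
  have R: "R x \<in> c0" if "x \<in> c0" for x
    unfolding R_def by (rule c0_if[OF c0_shift_right[OF that] c0_zero])
  let ?A = "\<lambda>x. seq_scale l (R x)"
  have bound: "sup_norm (?A x) \<le> cmod l * sup_norm x" if x: "x \<in> c0" for x
  proof (rule sup_norm_le)
    fix n
    have "cmod (R x n) \<le> sup_norm x"
      using cmod_le_sup_norm[OF x] c0.nrm_nonneg[OF x] by (simp add: R_def)
    then show "cmod (?A x n) \<le> cmod l * sup_norm x"
      by (simp add: seq_scale_def norm_mult mult_left_mono)
  qed
  have A: "c0.bounded_operator ?A"
    unfolding c0.bounded_operator_def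
  proof (intro conjI ballI allI exI[of _ "cmod l"])
    fix x assume x: "x \<in> c0"
    show "?A x \<in> c0" by (rule c0_scale[OF R[OF x]])
    show "?A (x + z) = ?A x + ?A z" for z
      by (auto simp: fun_eq_iff R_def seq_scale_def algebra_simps)
    show "?A (seq_scale a x) = seq_scale a (?A x)" for a
      by (auto simp: fun_eq_iff R_def seq_scale_def)
    show "sup_norm (?A x) \<le> cmod l * sup_norm x" by (rule bound[OF x])
  qed
  have "seq_scale (-1) (R y) \<in> c0"
    by (rule c0_scale[OF R[OF y]])
  from c0.shifted_surjective[OF A bound _ _ this, of 1]
  obtain x where x: "x \<in> c0" and eq: "c0.shifted ?A 1 x = seq_scale (-1) (R y)"
    using l by auto
  have xn: "x n = l * R x n + R y n" for n
    using fun_cong[OF eq, of n] by (simp add: c0.shifted_def seq_scale_def algebra_simps)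
  have zero: "x n = 0" if "n mod 3 \<noteq> 0" for n
    using that by (simp add: xn[of n] R_def)
  have "shift_sum_minus 1 l x n = y n" for n
  proof (cases "n mod 3 = 0")
    case True
    then show ?thesis
      using xn[of "n + 3"] by (simp add: shift_sum_minus_apply R_def)
  next
    case False
    then have "\<not> n < 3 \<Longrightarrow> (n - 3) mod 3 \<noteq> 0"
      by presburger
    then show ?thesis
      using False zero supp by (simp add: shift_sum_minus_apply)
  qed
  then show thesis
    using that[OF x zero] by blast
qed

text \<open>
  The geometric sequence of ratio \<open>l\<close> is an eigenvector of \<open>L\<close> for \<open>l\<close>, and by surjectivity of \<open>L - l\<close>
  it has preimages under all powers of \<open>L - l\<close>.
\<close>

lemma ascent_shift_sum_minus_1: "c0.ascent (shift_sum_minus 1 l) = \<infinity>" if l: "cmod l < 1"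
proof -
  let ?v = "geometric_seq 0 l"
  have "?v 0 = 1"
    by (simp add: geometric_seq_def)
  then have "?v \<noteq> 0" by (metis zero_fun_apply zero_neq_one)
  moreover have "shift_sum_minus 1 l ?v = 0"
  proof
    fix n :: nat
    have "n < 3 \<or> (n - 3) mod 3 = n mod 3"
      by presburger
    then show "shift_sum_minus 1 l ?v n = 0 n"
      by (auto simp: shift_sum_minus_apply geometric_seq_def)
  qed
  moreover have "\<exists>x\<in>c0. (\<forall>n. n mod 3 \<noteq> 0 \<longrightarrow> x n = 0) \<and> (shift_sum_minus 1 l ^^ p) x = ?v" for p
  proof (induction p)
    case 0
    show ?case
      using geometric_seq_in_c0[OF l] by (intro bexI[of _ ?v]) (simp_all add: geometric_seq_def)
  next
    case (Suc p)
    then obtain y where y: "y \<in> c0" "\<And>n. n mod 3 \<noteq> 0 \<Longrightarrow> y n = 0" "(shift_sum_minus 1 l ^^ p) y = ?v"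
      by blast
    obtain x where "x \<in> c0" "\<And>n. n mod 3 \<noteq> 0 \<Longrightarrow> x n = 0" "shift_sum_minus 1 l x = y"
      using shift_sum_minus_1_onto_multiples[OF l y(1,2)] by blast
    then show ?case
      using y(3) by (intro bexI[of _ x]) (simp_all add: funpow_Suc_right del: funpow.simps)
  qed
  ultimately show ?thesis
    by (intro c0.ascent_eq_infinity[of ?v]) blast+
qed

lemma null_vector_shift_sum_minus_1:
  assumes null: "shift_sum_minus 1 l x = 0"
  shows "x = seq_scale (x 0) (geometric_seq 0 l)"
proof
  fix n :: nat
  have zero: "shift_sum_minus 1 l 0 = 0"
    by (simp add: fun_eq_iff shift_sum_minus_apply)
  have power: "x (3 * k) = x 0 * l ^ k" for k
  proof (induction k)
    case (Suc k)
    have "x (3 * Suc k) = l * x (3 * k)"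
      using fun_cong[OF null, of "3 * k"] by (simp add: shift_sum_minus_apply add.commute)
    then show ?case
      using Suc by simp
  qed simp
  show "x n = seq_scale (x 0) (geometric_seq 0 l) n"
  proof (cases "n mod 3 = 0")
    case True
    then have "3 * (n div 3) = n" by presburger
    then have "x n = x 0 * l ^ (n div 3)"
      using power[of "n div 3"] by simp
    then show ?thesis
      using True by (simp add: seq_scale_def geometric_seq_def)
  next
    case False
    then have "x n = 0"
      using shift_sum_minus_eq_off_multiples[of 1 l x 0 n] by (simp add: null zero)
    then show ?thesis
      using False by (simp add: seq_scale_def geometric_seq_def)
  qed
qed

lemma ascent_shift_sum_minus_1_on_circle: "c0.ascent (shift_sum_minus 1 l) = 0" if l: "cmod l = 1"
proof (rule c0.ascent_eq_0)
  show "shift_sum_minus 1 l 0 = 0"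
    by (simp add: fun_eq_iff shift_sum_minus_apply)
  fix x assume x: "x \<in> c0" and null: "shift_sum_minus 1 l x = 0"
  have eq: "x n = x 0 * geometric_seq 0 l n" for n
    using fun_cong[OF null_vector_shift_sum_minus_1[OF null], of n] by (simp add: seq_scale_def)
  have "cmod (x (3 * k + 0)) = cmod (x 0)" for k
    using eq[of "3 * k"] l by (simp add: geometric_seq_def norm_mult norm_power)
  then have "(\<lambda>k::nat. cmod (x 0)) \<longlonglongrightarrow> 0"
    using tendsto_norm_zero[OF c0_residue_class[OF x, of 0]] by simp
  then have "x 0 = 0"
    by (simp add: LIMSEQ_const_iff)
  then have "x n = 0" for n
    using eq[of n] by simp
  then show "x = 0"
    by (simp add: fun_eq_iff)
qed

lemma nullity_shift_sum_minus_1: "c0.nullity (shift_sum_minus 1 l) \<le> 1"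
proof -
  have "x \<in> c0.span {geometric_seq 0 l}" if "shift_sum_minus 1 l x = 0" for x
  proof -
    have "seq_scale (x 0) (geometric_seq 0 l) \<in> c0.span {geometric_seq 0 l}"
      by (intro c0.span_scale c0.span_base) simp
    then show ?thesis
      by (simp only: null_vector_shift_sum_minus_1[OF that, symmetric])
  qed
  then have "c0.null_space (shift_sum_minus 1 l) \<subseteq> c0.span {geometric_seq 0 l}"
    by (auto simp: c0.null_space_def)
  then show ?thesis
    unfolding c0.nullity_def using c0.edim_le_card[of "{geometric_seq 0 l}"] by (simp add: one_enat_def)
qed

lemma deficiency_shift_sum_minus:
  assumes c: "cmod c \<le> 1" and l: "cmod l \<le> 1"
  shows "2 \<le> c0.deficiency (shift_sum_minus c l)"
proof -
  let ?W = "c0.range_space (shift_sum_minus c l)"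
  have ne: "unit_seq 1 \<noteq> unit_seq 2"
    using inj_onD[OF inj_unit_seq, of 1 2 UNIV] by auto
  have "enat (card {unit_seq 1, unit_seq 2}) \<le> c0.codim ?W"
  proof (rule c0.card_le_codim)
    show "c0.subspace ?W"
      by (rule c0.subspace_range_shifted[OF bounded_operator_shift_sum[OF c]])
    show "{unit_seq 1, unit_seq 2} \<subseteq> c0"
      by (simp add: unit_seq_in_c0)
    fix a assume "(\<Sum>b\<in>{unit_seq 1, unit_seq 2}. seq_scale (a b) b) \<in> ?W"
    then obtain x where x: "x \<in> c0"
      and eq: "shift_sum_minus c l x = seq_scale (a (unit_seq 1)) (unit_seq 1) + seq_scale (a (unit_seq 2)) (unit_seq 2)"
      using ne by (auto simp: c0.range_space_def)
    have apply_eq: "shift_sum_minus c l x n =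
        (if n = 1 then a (unit_seq 1) else if n = 2 then a (unit_seq 2) else 0)" for n
      unfolding eq by (simp add: seq_scale_def unit_seq_def)
    have "shift_sum_minus c l x j = 0" if "j = 1 \<or> j = 2" for j
      by (rule shift_sum_minus_leading_entry[OF x l that]) (use that in \<open>auto simp: apply_eq\<close>)
    from this[of 1] this[of 2] show "\<forall>b\<in>{unit_seq 1, unit_seq 2}. a b = 0"
      by (simp add: apply_eq)
  qed simp
  then show ?thesis
    using ne by (simp add: c0.deficiency_def numeral_eq_enat numeral_2_eq_2)
qed

lemma index_shift_sum_minus_1: "c0.index (shift_sum_minus 1 l) < 0" if "cmod l \<le> 1"
proof -
  have "c0.nullity (shift_sum_minus 1 l) \<le> 1" "2 \<le> c0.deficiency (shift_sum_minus 1 l)"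
    using nullity_shift_sum_minus_1 deficiency_shift_sum_minus[of 1 l] that by auto
  then show ?thesis
    unfolding c0.index_def
    by (cases "c0.nullity (shift_sum_minus 1 l)"; cases "c0.deficiency (shift_sum_minus 1 l)")
      (auto simp: one_enat_def numeral_eq_enat zero_ereal_def)
qed

lemma Delta_shift_sum_1: "c0.Delta (shift_sum 1) = {}"
proof -
  have "l \<notin> c0.Delta (shift_sum 1)" for l
  proof (cases "cmod l \<le> 1")
    case True
    then show ?thesis
      using index_shift_sum_minus_1[OF True] by (auto simp: c0.Delta_def c0.Weyl_spectrum_def)
  next
    case False
    then show ?thesis
      using not_in_spectrum_outside_disc[of 1 l] by (simp add: c0.Delta_def)
  qed
  then show ?thesis by blast
qed

text \<open>
  The ascent is infinite in the open disc; on the circle the ascent is 0 but the range of the first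
  power is not closed; outside the closed disc there is no approximate point spectrum.
\<close>

lemma left_poles_shift_sum_1: "c0.left_poles (shift_sum 1) = {}"
proof -
  have "l \<notin> c0.left_poles (shift_sum 1)" for l
  proof -
    consider "cmod l < 1" | "cmod l = 1" | "1 < cmod l"
      by fastforce
    then show ?thesis
    proof cases
      case 1
      then show ?thesis
        by (simp add: c0.left_poles_def ascent_shift_sum_minus_1)
    next
      case 2
      then show ?thesis
        using range_not_closed_on_circle[of 1 l]
        by (auto simp: c0.left_poles_def ascent_shift_sum_minus_1_on_circle zero_enat_def)
    next
      case 3
      then show ?thesis
        using not_in_approximate_point_spectrum_outside_disc[of 1 l] by (simp add: c0.left_poles_def)
    qed
  qed
  then show ?thesis by blast
qed

lemma range_shift_sum_1: "c0.range_space (shift_sum 1) = {y \<in> c0. \<forall>n\<in>{1, 2}. y n = 0}"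
proof (intro equalityI subsetI)
  fix y assume "y \<in> c0.range_space (shift_sum 1)"
  then show "y \<in> {y \<in> c0. \<forall>n\<in>{1, 2}. y n = 0}"
    by (auto simp: c0.range_space_def shift_sum_in_c0) (simp_all add: shift_sum_def)
next
  fix y :: "nat \<Rightarrow> complex" assume y: "y \<in> {y \<in> c0. \<forall>n\<in>{1, 2}. y n = 0}"
  define x where "x = (\<lambda>n. if n mod 3 = 0 then y (n - 3) else y (n + 3))"
  have "x \<in> c0"
    unfolding x_def using y by (intro c0_if[OF c0_shift_right c0_shift_left]) auto
  moreover have "shift_sum 1 x n = y n" for n
  proof -
    have "n = 1 \<or> n = 2" if "n mod 3 \<noteq> 0" "n < 3"
      using that by presburger
    moreover have "(n - 3) mod 3 \<noteq> 0" if "n mod 3 \<noteq> 0" "\<not> n < 3"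
      using that by presburger
    ultimately show ?thesis
      using y by (auto simp: shift_sum_def x_def)
  qed
  ultimately show "y \<in> c0.range_space (shift_sum 1)"
    unfolding c0.range_space_def by (metis ext image_eqI)
qed

lemma zero_in_Delta_a_shift_sum_1: "0 \<in> c0.Delta_a (shift_sum 1)"
proof -
  have "0 \<in> c0.approximate_point_spectrum (shift_sum 1)"
    by (rule zero_in_approximate_point_spectrum_shift_sum) simp
  moreover have "closedin c0.mtopology (c0.range_space (shift_sum_minus 1 0))"
    unfolding shift_sum_minus_0 range_shift_sum_1 by (rule closedin_c0_vanishing)
  moreover have "c0.nullity (shift_sum_minus 1 0) < \<infinity>"
    using nullity_shift_sum_minus_1[of 0] by (rule le_less_trans) (simp add: one_enat_def)
  ultimately show ?thesis
    using index_shift_sum_minus_1[of 0]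
    by (simp add: c0.Delta_a_def c0.upper_semi_Weyl_spectrum_def c0.upper_semi_Fredholm_def)
qed

lemma property_Z_Pi_a_shift_sum_1: "c0.property_Z_Pi_a (shift_sum 1)"
  by (simp add: c0.property_Z_Pi_a_def Delta_shift_sum_1 left_poles_shift_sum_1)

lemma not_property_UW_Pi_shift_sum_1: "\<not> c0.property_UW_Pi (shift_sum 1)"
  using zero_in_Delta_a_shift_sum_1 by (auto simp: c0.property_UW_Pi_def poles_shift_sum)

section \<open>Independence of the two properties\<close>

theorem proposition3p6:
  "(\<exists>(X :: (nat \<Rightarrow> complex) set) (nrm :: (nat \<Rightarrow> complex) \<Rightarrow> real) T.
      complex_banach_space seq_scale X nrm \<and>
      complex_normed_space.infinite_dimensional seq_scale X \<and>
      complex_normed_space.bounded_operator seq_scale X nrm T \<and>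
      complex_normed_space.property_UW_Pi seq_scale X nrm T \<and>
      \<not> complex_normed_space.property_Z_Pi_a seq_scale X nrm T) \<and>
   (\<exists>(Y :: (nat \<Rightarrow> complex) set) (nrm :: (nat \<Rightarrow> complex) \<Rightarrow> real) S.
      complex_banach_space seq_scale Y nrm \<and>
      complex_normed_space.infinite_dimensional seq_scale Y \<and>
      complex_normed_space.bounded_operator seq_scale Y nrm S \<and>
      complex_normed_space.property_Z_Pi_a seq_scale Y nrm S \<and>
      \<not> complex_normed_space.property_UW_Pi seq_scale Y nrm S)"
proof (intro conjI exI)
  note c0_facts = c0.complex_banach_space_axioms infinite_dimensional_c0
  show "complex_banach_space seq_scale c0 sup_norm" "c0.infinite_dimensional"
    "complex_banach_space seq_scale c0 sup_norm" "c0.infinite_dimensional"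
    by (fact c0_facts)+
  show "c0.bounded_operator (shift_sum 0)" "c0.bounded_operator (shift_sum 1)"
    by (simp_all add: bounded_operator_shift_sum)
  show "c0.property_UW_Pi (shift_sum 0)"
    by (rule property_UW_Pi_shift_sum_0)
  show "\<not> c0.property_Z_Pi_a (shift_sum 0)"
    by (rule not_property_Z_Pi_a_shift_sum_0)
  show "c0.property_Z_Pi_a (shift_sum 1)"
    by (rule property_Z_Pi_a_shift_sum_1)
  show "\<not> c0.property_UW_Pi (shift_sum 1)"
    by (rule not_property_UW_Pi_shift_sum_1)
qed

end
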